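(* Let $\mathcal{H}$ be a separable complex Hilbert space and let $T \in B(\mathcal{H})$ be a partial isometry with $\operatorname{rank} T \leq 2$. Then $T$ is complex symmetric.
   Context: $B(\mathcal{H})$ denotes the bounded linear operators on $\mathcal{H}$. A conjugation on a complex Hilbert space $\mathcal{H}$ is a conjugate-linear operator $C:\mathcal{H}\to\mathcal{H}$ which is involutive ($C^2 = I$) and isometric ($\langle Cx, Cy\rangle = \langle y, x\rangle$ for all $x,y \in \mathcal{H}$). An operator $T \in B(\mathcal{H})$ is $C$-symmetric if $T = CT^*C$, and $T$ is complex symmetric if there exists a conjugation $C$ on $\mathcal{H}$ with respect to which $T$ is $C$-symmetric. *)

theory Defs
  imports "HOL-Analysis.Analysis" "HOL-Library.Extended_Nat"
begin

section \<open>Complex Hilbert spaces\<close>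

text \<open>
  A complex inner product space extends its underlying real inner product space, whose inner
  product is the real part of the complex one. Hence norm, metric and topology are those
  of \<open>real_inner\<close>. The complex inner product is linear in its first argument.
\<close>

class complex_inner = real_inner +
  fixes scaleC :: "complex \<Rightarrow> 'a \<Rightarrow> 'a"  (infixr \<open>*\<^sub>C\<close> 75)
    and cinner :: "'a \<Rightarrow> 'a \<Rightarrow> complex"
  assumes scaleC_add_right: "c *\<^sub>C (x + y) = c *\<^sub>C x + c *\<^sub>C y"
    and scaleC_add_left: "(c + d) *\<^sub>C x = c *\<^sub>C x + d *\<^sub>C x"
    and scaleC_scaleC: "c *\<^sub>C d *\<^sub>C x = (c * d) *\<^sub>C x"
    and scaleC_one: "1 *\<^sub>C x = x"
    and scaleR_scaleC: "scaleR r x = complex_of_real r *\<^sub>C x"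
    and cinner_commute: "cinner x y = cnj (cinner y x)"
    and cinner_add_left: "cinner (x + y) z = cinner x z + cinner y z"
    and cinner_scaleC_left: "cinner (c *\<^sub>C x) y = c * cinner x y"
    and inner_eq_Re_cinner: "inner x y = Re (cinner x y)"

class chilbert_space = complex_inner + complete_space

global_interpretation complex_vector: vector_space "scaleC :: complex \<Rightarrow> 'a \<Rightarrow> 'a::complex_inner"
  defines cdependent = complex_vector.dependent
    and crepresentation = complex_vector.representation
    and csubspace = complex_vector.subspace
    and cspan = complex_vector.span
    and cextend_basis = complex_vector.extend_basis
    and cdim = complex_vector.dim
  by standard (simp_all add: scaleC_add_right scaleC_add_left scaleC_scaleC scaleC_one)

instantiation complex :: chilbert_space
begin

definition scaleC_complex :: "complex \<Rightarrow> complex \<Rightarrow> complex"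
  where "scaleC_complex c z = c * z"

definition cinner_complex :: "complex \<Rightarrow> complex \<Rightarrow> complex"
  where "cinner_complex z w = z * cnj w"

instance
  by standard
    (auto simp: scaleC_complex_def cinner_complex_def inner_complex_def algebra_simps scaleR_conv_of_real)

end

lemma cinner_self: "cinner x x = complex_of_real ((norm x)\<^sup>2)"
  for x :: "'a::complex_inner"
proof -
  have "cnj (cinner x x) = cinner x x"
    by (metis cinner_commute)
  then have "Im (cinner x x) = 0"
    by (metis Reals_cnj_iff complex_is_Real_iff)
  then show ?thesis
    by (simp add: complex_eq_iff power2_norm_eq_inner inner_eq_Re_cinner)
qed

lemma cinner_add_right: "cinner x (y + z) = cinner x y + cinner x z"
  by (metis cinner_add_left cinner_commute complex_cnj_add)

lemma cinner_scaleC_right: "cinner x (c *\<^sub>C y) = cnj c * cinner x y"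
  by (metis cinner_commute cinner_scaleC_left complex_cnj_mult)

lemma cinner_diff_right: "cinner x (y - z) = cinner x y - cinner x z"
  by (metis add_diff_cancel cinner_add_right diff_add_cancel)


section \<open>Bounded operators and adjoints\<close>

definition bounded_clinear :: "('a::complex_inner \<Rightarrow> 'b::complex_inner) \<Rightarrow> bool"
  where "bounded_clinear T \<longleftrightarrow> bounded_linear T \<and> (\<forall>c x. T (c *\<^sub>C x) = c *\<^sub>C T x)"

definition cadjoint :: "('a::complex_inner \<Rightarrow> 'b::complex_inner) \<Rightarrow> 'b \<Rightarrow> 'a"
  where "cadjoint T = (THE S. \<forall>x y. cinner (T x) y = cinner x (S y))"

lemma cadjoint_eqI:
  assumes S: "\<And>x y. cinner (T x) y = cinner x (S y)"
  shows "cadjoint T = S"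
  unfolding cadjoint_def
proof (rule the_equality)
  show "\<forall>x y. cinner (T x) y = cinner x (S y)"
    using S by simp
next
  fix R assume R: "\<forall>x y. cinner (T x) y = cinner x (R y)"
  show "R = S"
  proof
    fix y
    have "cinner (R y - S y) (R y - S y) = 0"
      using S[of "R y - S y" y] R by (simp add: cinner_diff_right)
    then show "R y = S y"
      by (simp add: cinner_self)
  qed
qed

text \<open>The Riesz representation theorem shows that \<open>cadjoint\<close> is well defined on bounded operators.\<close>

lemma riesz_real:
  fixes f :: "'a::{real_inner, complete_space} \<Rightarrow> real"
  assumes f: "bounded_linear f"
  shows "\<exists>z. \<forall>x. f x = inner x z"
proof -
  interpret f: bounded_linear f by fact
  define J where "J x = inner x x / 2 - f x" for x
  obtain K where K: "\<And>x. norm (f x) \<le> norm x * K"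
    using f.bounded by blast
  have low: "- (K\<^sup>2) / 2 \<le> J x" for x
  proof -
    have "0 \<le> (norm x - K)\<^sup>2" by simp
    moreover have "f x \<le> norm x * K" using K[of x] by simp
    ultimately show ?thesis
      unfolding J_def power2_norm_eq_inner[symmetric] by (simp add: power2_eq_square algebra_simps)
  qed
  define m where "m = (INF x. J x)"
  have bdd: "bdd_below (range J)"
    using low by (auto intro!: bdd_belowI)
  have m_le: "m \<le> J x" for x
    unfolding m_def by (rule cINF_lower[OF bdd]) simp
  have "\<exists>x. J x < m + 1 / real (Suc n)" for n
    using cINF_less_iff[OF _ bdd, of "m + 1 / real (Suc n)"] by (auto simp: m_def)
  then obtain X where X: "\<And>n. J (X n) < m + 1 / real (Suc n)"
    by metis
  have par: "inner (u - v) (u - v) = 4 * (J u + J v - 2 * J ((1/2) *\<^sub>R (u + v)))" for u v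
    by (simp add: J_def f.add f.scaleR inner_add inner_diff inner_commute algebra_simps)
  have close: "(norm (X n - X k))\<^sup>2 < 4 * (1 / real (Suc n) + 1 / real (Suc k))" for n k
  proof -
    have *: "d < 4 * (p + q)" if "d = 4 * (a + b - 2 * c)" "a < m + p" "b < m + q" "m \<le> c"
      for a b c d p q :: real
      using that by simp
    show ?thesis
      unfolding power2_norm_eq_inner
      by (rule *[OF par X X m_le])
  qed
  have "Cauchy X"
  proof (rule CauchyI)
    fix e :: real assume e: "0 < e"
    obtain M where M: "inverse (real (Suc M)) < e\<^sup>2 / 8"
      using reals_Archimedean[of "e\<^sup>2 / 8"] e by auto
    have "norm (X n - X k) < e" if "M \<le> n" "M \<le> k" for n k
    proof -
      have *: "d < e\<^sup>2" if "d < 4 * (p + q)" "p \<le> r" "q \<le> r" "r < e\<^sup>2 / 8" for d p q r :: real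
        using that by simp
      have "1 / real (Suc n) \<le> inverse (real (Suc M))" "1 / real (Suc k) \<le> inverse (real (Suc M))"
        using that by (simp_all add: field_simps)
      then have "(norm (X n - X k))\<^sup>2 < e\<^sup>2"
        by (rule *[OF close _ _ M])
      then show ?thesis
        using e by (simp add: power2_less_imp_less)
    qed
    then show "\<exists>M. \<forall>n\<ge>M. \<forall>k\<ge>M. norm (X n - X k) < e" by blast
  qed
  then obtain z where z: "X \<longlonglongrightarrow> z"
    using Cauchy_convergent convergent_def by blast
  have "(\<lambda>n. J (X n)) \<longlonglongrightarrow> J z"
    unfolding J_def by (intro tendsto_intros z f.tendsto) simp
  moreover have "(\<lambda>n. m + 1 / real (Suc n)) \<longlonglongrightarrow> m + 0"
    by (intro tendsto_intros LIMSEQ_inverse_real_of_nat[unfolded inverse_eq_divide])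
  ultimately have "J z \<le> m + 0"
    by (rule LIMSEQ_le) (use X less_imp_le in blast)
  then have Jz: "J z \<le> J x" for x
    using m_le[of x] by simp
  have "f h = inner h z" for h
  proof (rule ccontr)
    assume ne: "f h \<noteq> inner h z"
    define a where "a = f h - inner h z"
    define b where "b = inner h h"
    have b: "0 < b"
      using ne unfolding b_def by (cases "h = 0") (auto simp: f.zero)
    have "J (z + t *\<^sub>R h) = J z - t * a + t\<^sup>2 * b / 2" for t
      by (simp add: J_def a_def b_def f.add f.scaleR inner_add inner_commute power2_eq_square
          algebra_simps)
    then have "J (z + (a / b) *\<^sub>R h) = J z - (a / b) * a + (a / b)\<^sup>2 * b / 2" .
    also have "\<dots> = J z - a\<^sup>2 / (2 * b)"
      using b by (simp add: field_simps power2_eq_square)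
    finally have "a\<^sup>2 / (2 * b) \<le> 0"
      using Jz[of "z + (a / b) *\<^sub>R h"] by simp
    moreover have "0 < a\<^sup>2 / (2 * b)"
      using b ne by (simp add: a_def)
    ultimately show False by simp
  qed
  then show ?thesis by blast
qed

lemma cinner_cadjoint:
  fixes T :: "'a::chilbert_space \<Rightarrow> 'b::complex_inner"
  assumes T: "bounded_clinear T"
  shows "cinner (T x) y = cinner x (cadjoint T y)"
proof -
  have bl: "bounded_linear T" and sc: "\<And>c x. T (c *\<^sub>C x) = c *\<^sub>C T x"
    using T by (auto simp: bounded_clinear_def)
  have "\<exists>z. \<forall>x. inner (T x) y = inner x z" for y
    by (rule riesz_real) (intro bounded_linear_compose[OF bounded_linear_inner_left bl])
  then obtain S where S: "\<And>x y. inner (T x) y = inner x (S y)"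
    by metis
  have "cinner (T x) y = cinner x (S y)" for x y
    using S[of x y] S[of "\<i> *\<^sub>C x" y]
    by (simp add: complex_eq_iff inner_eq_Re_cinner sc cinner_scaleC_left)
  then show ?thesis
    using cadjoint_eqI by metis
qed

definition partial_isometry :: "('a::complex_inner \<Rightarrow> 'b::complex_inner) \<Rightarrow> bool"
  where "partial_isometry T \<longleftrightarrow>
    bounded_clinear T \<and> (\<forall>x. (\<forall>y. T y = 0 \<longrightarrow> cinner x y = 0) \<longrightarrow> norm (T x) = norm x)"

text \<open>
  The rank is an extended natural number, since \<open>cdim\<close> is \<open>0\<close> on spaces of infinite
  dimension.
\<close>

definition crank :: "('a::complex_inner \<Rightarrow> 'b::complex_inner) \<Rightarrow> enat"
  where "crank T = (if \<exists>B. finite B \<and> cspan B = cspan (range T) then enat (cdim (range T)) else \<infinity>)"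


section \<open>Complex symmetric operators\<close>

definition conjugation :: "('a::complex_inner \<Rightarrow> 'a) \<Rightarrow> bool"
  where "conjugation C \<longleftrightarrow>
    (\<forall>x y. C (x + y) = C x + C y) \<and>
    (\<forall>c x. C (c *\<^sub>C x) = cnj c *\<^sub>C C x) \<and>
    (\<forall>x. C (C x) = x) \<and>
    (\<forall>x y. cinner (C x) (C y) = cinner y x)"

definition C_symmetric :: "('a::complex_inner \<Rightarrow> 'a) \<Rightarrow> ('a \<Rightarrow> 'a) \<Rightarrow> bool"
  where "C_symmetric C T \<longleftrightarrow> T = C \<circ> cadjoint T \<circ> C"

definition complex_symmetric :: "('a::complex_inner \<Rightarrow> 'a) \<Rightarrow> bool"
  where "complex_symmetric T \<longleftrightarrow> (\<exists>C. conjugation C \<and> C_symmetric C T)"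

end

theory Submission
  imports Defs
begin

text \<open>
  A conjugation \<open>C\<close> is the same thing as a real form of the Hilbert space: the set \<open>V\<close> of its fixed
  vectors is a closed real subspace on which the inner product is real and with \<open>H = V + \<i> V\<close>.
  In these terms \<open>T\<close> is \<open>C\<close>-symmetric exactly when \<open>\<langle>T v, w\<rangle> = \<langle>T w, v\<rangle>\<close> for all \<open>v, w\<close> in \<open>V\<close>.
  Both conditions on \<open>V\<close> concern pairs of vectors, so a set satisfying them extends, by Zorn's lemma,
  to a maximal one; maximality alone makes it a closed real subspace. It is a real form as soon
  as the initial set is so large that \<open>T\<close> and its adjoint vanish on the orthogonal complement of
  that set, because then every vector orthogonal to \<open>V\<close> could be added to \<open>V\<close>
  (\<open>complex_symmetric_if_symmetric_on_support\<close>). Only the finite-dimensional part of the space on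
  which \<open>T\<close> lives has to be treated by hand.

  There the initial space \<open>M = (ker T)\<^sup>\<bottom>\<close> decides (Garcia and Wogen): if \<open>M\<close> has an orthonormal basis
  \<open>E\<close> in which the matrix \<open>\<langle>T e, f\<rangle>\<close> is symmetric, then \<open>T\<close> is complex symmetric. The desired
  conjugation must exchange \<open>e\<close> and \<open>T e\<close>, so it fixes \<open>e + T e\<close> and \<open>\<i> (e - T e)\<close>, and these
  vectors form the initial set (\<open>complex_symmetric_if_symmetric_matrix\<close>).

  Since \<open>T\<close> is injective on \<open>M\<close>, rank at most \<open>2\<close> means that \<open>M\<close> has dimension at most \<open>2\<close>, and every
  complex matrix of size at most two is unitarily equivalent to a symmetric one
  (\<open>symmetric_orthonormal_pair\<close>).
\<close>

section \<open>Inner products and orthogonal projections\<close>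

lemma cinner_zero_left [simp]: "cinner 0 x = 0"
  by (metis add_cancel_right_right cinner_add_left)

lemma cinner_zero_right [simp]: "cinner x 0 = 0"
  by (metis cinner_commute cinner_zero_left complex_cnj_zero)

lemma cinner_diff_left: "cinner (x - y) z = cinner x z - cinner y z"
  by (metis add_diff_cancel cinner_add_left diff_add_cancel)

lemma cinner_minus_left: "cinner (- x) y = - cinner x y"
  using cinner_diff_left[of 0 x y] by simp

lemma cinner_scaleR_left: "cinner (scaleR r x) y = complex_of_real r * cinner x y"
  by (simp add: scaleR_scaleC cinner_scaleC_left)

lemma cinner_scaleR_right: "cinner x (scaleR r y) = complex_of_real r * cinner x y"
  by (simp add: scaleR_scaleC cinner_scaleC_right)

lemma cinner_sum_left: "cinner (sum f A) y = (\<Sum>a\<in>A. cinner (f a) y)"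
  by (induction A rule: infinite_finite_induct) (simp_all add: cinner_add_left)

lemma cinner_self_eq_0_iff [simp]: "cinner x x = 0 \<longleftrightarrow> x = 0"
  by (simp add: cinner_self)

lemma Im_cinner_eq_inner: "Im (cinner x y) = inner x (\<i> *\<^sub>C y)"
  by (simp add: inner_eq_Re_cinner cinner_scaleC_right)

lemma cinner_eq_Complex_inner: "cinner x y = Complex (inner x y) (inner x (\<i> *\<^sub>C y))"
  by (simp add: complex_eq_iff Im_cinner_eq_inner inner_eq_Re_cinner)

lemma continuous_on_cinner_left:
  assumes "continuous_on A f"
  shows "continuous_on A (\<lambda>x. cinner (f x) y)"
  unfolding cinner_eq_Complex_inner Complex_eq
  by (intro continuous_intros assms)

lemma bounded_clinearD:
  assumes "bounded_clinear T"
  shows "T (x + y) = T x + T y" "T (x - y) = T x - T y" "T (c *\<^sub>C x) = c *\<^sub>C T x"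
    "T (scaleR r x) = scaleR r (T x)" "T 0 = 0" "continuous_on A T"
proof -
  interpret bounded_linear T
    using assms by (simp add: bounded_clinear_def)
  show "T (x + y) = T x + T y" "T (x - y) = T x - T y" "T (scaleR r x) = scaleR r (T x)" "T 0 = 0"
    by (simp_all add: add diff scaleR zero)
  show "continuous_on A T"
    by (rule linear_continuous_on) (rule bounded_linear_axioms)
  show "T (c *\<^sub>C x) = c *\<^sub>C T x"
    using assms by (simp add: bounded_clinear_def)
qed

text \<open>
  The point of \<open>V\<close> closest to \<open>x\<close>: by the parallelogram law a minimising sequence for the distance
  is Cauchy, and its limit is the foot of the perpendicular. The subspace is only real, so that the
  result applies to real forms of a complex space as well as to kernels.
\<close>

lemma closed_subspace_projection:
  fixes V :: "'a::{real_inner, complete_space} set"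
  assumes V: "subspace V" and closed: "closed V"
  shows "\<exists>p\<in>V. \<forall>v\<in>V. inner (x - p) v = 0"
proof -
  define J where "J v = (norm (x - v))\<^sup>2" for v
  define m where "m = (INF v\<in>V. J v)"
  have ne: "V \<noteq> {}"
    using subspace_0[OF V] by auto
  have bdd: "bdd_below (J ` V)"
    by (rule bdd_belowI2[of _ 0]) (simp add: J_def)
  have m_le: "m \<le> J v" if "v \<in> V" for v
    unfolding m_def using bdd that by (rule cINF_lower)
  have "\<exists>v\<in>V. J v < m + 1 / real (Suc n)" for n
    using cINF_less_iff[OF ne bdd, of "m + 1 / real (Suc n)"] by (auto simp: m_def)
  then obtain X where XV: "\<And>n. X n \<in> V" and X: "\<And>n. J (X n) < m + 1 / real (Suc n)"
    by metis
  have par: "(norm (u - v))\<^sup>2 = 2 * (J u + J v - 2 * J ((1/2) *\<^sub>R (u + v)))" for u v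
    by (simp add: J_def power2_norm_eq_inner inner_add inner_diff inner_commute algebra_simps)
  have close: "(norm (X n - X k))\<^sup>2 < 2 * (1 / real (Suc n) + 1 / real (Suc k))" for n k
  proof -
    have "m \<le> J ((1/2) *\<^sub>R (X n + X k))"
      by (intro m_le subspace_scale[OF V] subspace_add[OF V] XV)
    moreover have "2 * (a + b - 2 * c) < 2 * (p + q)" if "a < m + p" "b < m + q" "m \<le> c"
      for a b c p q :: real
      using that by simp
    ultimately show ?thesis
      unfolding par using X by blast
  qed
  have "Cauchy X"
  proof (rule CauchyI)
    fix e :: real assume e: "0 < e"
    obtain M where M: "inverse (real (Suc M)) < e\<^sup>2 / 4"
      using reals_Archimedean[of "e\<^sup>2 / 4"] e by auto
    have "norm (X n - X k) < e" if "M \<le> n" "M \<le> k" for n k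
    proof -
      have *: "d < e\<^sup>2" if "p \<le> r" "q \<le> r" "d < 2 * (p + q)" "r < e\<^sup>2 / 4" for d p q r :: real
        using that by simp
      have "1 / real (Suc n) \<le> inverse (real (Suc M))" "1 / real (Suc k) \<le> inverse (real (Suc M))"
        using that by (simp_all add: field_simps)
      then have "(norm (X n - X k))\<^sup>2 < e\<^sup>2"
        using * close M by blast
      then show ?thesis
        using e by (simp add: power2_less_imp_less)
    qed
    then show "\<exists>M. \<forall>n\<ge>M. \<forall>k\<ge>M. norm (X n - X k) < e" by blast
  qed
  then obtain z where z: "X \<longlonglongrightarrow> z"
    using Cauchy_convergent convergent_def by blast
  have zV: "z \<in> V"
    using closed XV z closed_sequentially by blast
  have "(\<lambda>n. J (X n)) \<longlonglongrightarrow> J z"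
    unfolding J_def by (intro tendsto_intros z)
  moreover have "(\<lambda>n. m + 1 / real (Suc n)) \<longlonglongrightarrow> m + 0"
    by (intro tendsto_intros LIMSEQ_inverse_real_of_nat[unfolded inverse_eq_divide])
  ultimately have "J z \<le> m + 0"
    by (rule LIMSEQ_le) (use X less_imp_le in blast)
  then have "J z \<le> J v" if "v \<in> V" for v
    using m_le[OF that] by simp
  then have closest: "\<forall>v\<in>V. dist x z \<le> dist x v"
    by (simp add: J_def dist_norm)
  have le: "inner (x - z) v \<le> 0" if "v \<in> V" for v
    using any_closest_point_dot[OF subspace_imp_convex[OF V] closed zV _ closest, of "z + v"]
      subspace_add[OF V zV that] by simp
  have "inner (x - z) v = 0" if "v \<in> V" for v
    using le[OF that] le[OF subspace_neg[OF V that]] by simp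
  then show ?thesis
    using zV by blast
qed


section \<open>Conjugations from real forms\<close>

text \<open>
  The condition that two fixed vectors of a conjugation \<open>C\<close> satisfy when \<open>T\<close> is \<open>C\<close>-symmetric.
\<close>

definition symmetric_pair :: "('a::complex_inner \<Rightarrow> 'a) \<Rightarrow> 'a \<Rightarrow> 'a \<Rightarrow> bool"
  where "symmetric_pair T x y \<longleftrightarrow> Im (cinner x y) = 0 \<and> cinner (T x) y = cinner (T y) x"

lemma symmetric_pair_commute: "symmetric_pair T x y \<longleftrightarrow> symmetric_pair T y x"
  using cinner_commute[of x y] by (auto simp: symmetric_pair_def complex_eq_iff)

lemma symmetric_pair_refl: "symmetric_pair T x x"
  by (simp add: symmetric_pair_def cinner_self)

lemma symmetric_pairs_subspace:
  assumes T: "bounded_clinear T"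
  shows "subspace {x. symmetric_pair T x y}"
proof -
  note T' = bounded_clinearD[OF T]
  show ?thesis
    by (auto simp: subspace_def symmetric_pair_def cinner_add_left cinner_add_right
        cinner_scaleR_left cinner_scaleR_right T')
qed

lemma symmetric_pairs_closed:
  assumes T: "bounded_clinear T"
  shows "closed {x. symmetric_pair T x y}"
proof -
  have "{x. symmetric_pair T x y}
    = {x. Im (cinner x y) = 0} \<inter> {x. cinner (T x) y = cnj (cinner x (T y))}"
    unfolding symmetric_pair_def by (subst cinner_commute[of "T y"]) blast
  moreover have "closed \<dots>"
    by (intro closed_Int closed_Collect_eq continuous_intros continuous_on_cinner_left
        bounded_clinearD(6)[OF T])
  ultimately show ?thesis by simp
qed

text \<open>
  A vector forms a symmetric pair with itself, so by maximality any vector that forms symmetric pairs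
  with all of \<open>V\<close> already lies in \<open>V\<close>. The resulting fixed-point equation exhibits \<open>V\<close> as an
  intersection of closed real subspaces.
\<close>

lemma maximal_symmetric_set:
  assumes "\<And>x y. x \<in> A \<Longrightarrow> y \<in> A \<Longrightarrow> symmetric_pair T x y"
  obtains V where "A \<subseteq> V" "V = {x. \<forall>y\<in>V. symmetric_pair T x y}"
proof -
  define F where "F = {S. A \<subseteq> S \<and> (\<forall>x\<in>S. \<forall>y\<in>S. symmetric_pair T x y)}"
  have "\<exists>V\<in>F. \<forall>S\<in>F. V \<subseteq> S \<longrightarrow> S = V"
  proof (rule subset_Zorn_nonempty)
    show "F \<noteq> {}"
      using assms unfolding F_def by blast
    fix \<C> assume ne: "\<C> \<noteq> {}" and ch: "subset.chain F \<C>"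
    have "symmetric_pair T x y" if "X \<in> \<C>" "x \<in> X" "Y \<in> \<C>" "y \<in> Y" for x y X Y
    proof -
      have "X \<subseteq> Y \<or> Y \<subseteq> X" "X \<in> F" "Y \<in> F"
        using ch that by (auto simp: subset_chain_def)
      then show ?thesis
        using that unfolding F_def by blast
    qed
    then show "\<Union>\<C> \<in> F"
      using ne ch unfolding F_def subset_chain_def by blast
  qed
  then obtain V where V: "V \<in> F" and max: "\<And>S. S \<in> F \<Longrightarrow> V \<subseteq> S \<Longrightarrow> S = V"
    by blast
  have "x \<in> V" if "\<forall>y\<in>V. symmetric_pair T x y" for x
  proof -
    have "insert x V \<in> F"
      using V that symmetric_pair_commute[of T] symmetric_pair_refl[of T] unfolding F_def by auto
    then show ?thesis
      using max by blast
  qed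
  then show thesis
    using that[of V] V unfolding F_def by blast
qed

text \<open>
  The identity \<open>T = C T\<^sup>* C\<close> tested against vectors: symmetry of the bilinear form \<open>\<langle>T x, C y\<rangle>\<close>, which
  does not mention the adjoint.
\<close>

lemma complex_symmetric_if_symmetric_form:
  fixes T :: "'a::chilbert_space \<Rightarrow> 'a"
  assumes T: "bounded_clinear T" and C: "conjugation C"
    and sym: "\<And>x y. cinner (T x) (C y) = cinner (T y) (C x)"
  shows "complex_symmetric T"
proof -
  have CC: "C (C x) = x" and Ciso: "cinner (C x) (C y) = cinner y x" for x y
    using C by (auto simp: conjugation_def)
  have "T x = C (cadjoint T (C x))" for x
  proof -
    have "cinner (C (cadjoint T (C x))) y = cinner (T x) y" for y
    proof -
      have "cinner (C (cadjoint T (C x))) y = cinner (C y) (cadjoint T (C x))"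
        by (metis CC Ciso)
      also have "\<dots> = cinner (T (C y)) (C x)"
        by (simp add: cinner_cadjoint[OF T])
      also have "\<dots> = cinner (T x) y"
        by (simp add: sym CC)
      finally show ?thesis .
    qed
    then have "cinner (T x - C (cadjoint T (C x))) (T x - C (cadjoint T (C x))) = 0"
      by (simp add: cinner_diff_left)
    then show ?thesis
      by simp
  qed
  then show ?thesis
    using C by (auto simp: complex_symmetric_def C_symmetric_def fun_eq_iff)
qed

text \<open>
  Projecting \<open>x\<close> and \<open>- \<i> x\<close> onto \<open>V\<close> gives the two components of \<open>x\<close> in \<open>V + \<i> V\<close>: the remainder is
  orthogonal to \<open>V\<close> for the complex inner product, hence \<open>0\<close>. The components are unique since
  \<open>v + \<i> w\<close> has squared norm \<open>|v|\<^sup>2 + |w|\<^sup>2\<close> when the inner product is real on \<open>V\<close>, and \<open>C\<close> is complex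
  conjugation in this decomposition.
\<close>

lemma complex_symmetric_if_symmetric_real_form:
  fixes T :: "'a::chilbert_space \<Rightarrow> 'a"
  assumes T: "bounded_clinear T"
    and V: "subspace V" "closed V"
    and pair: "\<And>x y. x \<in> V \<Longrightarrow> y \<in> V \<Longrightarrow> symmetric_pair T x y"
    and total: "\<And>x. (\<And>y. y \<in> V \<Longrightarrow> cinner x y = 0) \<Longrightarrow> x = 0"
  shows "complex_symmetric T"
proof -
  note T' = bounded_clinearD[OF T]
  have sym: "cinner (T x) y = cinner (T y) x" if "x \<in> V" "y \<in> V" for x y
    using pair[OF that] by (simp add: symmetric_pair_def)
  have comm: "cinner x y = cinner y x" if "x \<in> V" "y \<in> V" for x y
    using pair[OF that] cinner_commute[of x y]
    by (simp add: symmetric_pair_def complex_eq_iff)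
  have real: "Im (cinner x y) = 0" if "x \<in> V" "y \<in> V" for x y
    using pair[OF that] by (simp add: symmetric_pair_def)
  have "\<exists>v w. v \<in> V \<and> w \<in> V \<and> x = v + \<i> *\<^sub>C w" for x
  proof -
    obtain v where v: "v \<in> V" "\<And>y. y \<in> V \<Longrightarrow> inner (x - v) y = 0"
      using closed_subspace_projection[OF V] by blast
    obtain w where w: "w \<in> V" "\<And>y. y \<in> V \<Longrightarrow> inner ((- \<i>) *\<^sub>C x - w) y = 0"
      using closed_subspace_projection[OF V] by blast
    have "cinner (x - (v + \<i> *\<^sub>C w)) y = 0" if y: "y \<in> V" for y
      using v(2)[OF y] w(2)[OF y] real[OF v(1) y] real[OF w(1) y]
      by (simp add: complex_eq_iff inner_eq_Re_cinner cinner_diff_left cinner_add_left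
          cinner_minus_left cinner_scaleC_left)
    then have "x - (v + \<i> *\<^sub>C w) = 0"
      by (rule total)
    then show ?thesis
      using v(1) w(1) by auto
  qed
  then obtain v w where vV: "\<And>x. v x \<in> V" and wV: "\<And>x. w x \<in> V"
    and dec: "\<And>x. x = v x + \<i> *\<^sub>C w x"
    by metis
  have uniq: "p = q \<and> r = s" if "p + \<i> *\<^sub>C r = q + \<i> *\<^sub>C s" "p \<in> V" "q \<in> V" "r \<in> V" "s \<in> V"
    for p q r s
  proof -
    have a: "p - q \<in> V" and b: "r - s \<in> V"
      using that V by (auto intro: subspace_diff)
    have "(p - q) + \<i> *\<^sub>C (r - s) = 0"
      using that(1) by (simp add: complex_vector.scale_right_diff_distrib algebra_simps)
    then have "0 = cinner ((p - q) + \<i> *\<^sub>C (r - s)) ((p - q) + \<i> *\<^sub>C (r - s))"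
      by simp
    also have "\<dots> = cinner (p - q) (p - q) + cinner (r - s) (r - s)"
      using comm[OF a b]
      by (simp only: cinner_add_left cinner_add_right cinner_scaleC_left cinner_scaleC_right)
        (simp add: algebra_simps)
    finally have "(norm (p - q))\<^sup>2 + (norm (r - s))\<^sup>2 = 0"
      unfolding cinner_self by (metis of_real_add of_real_eq_0_iff)
    then show ?thesis
      by (simp add: sum_power2_eq_zero_iff)
  qed
  define C where "C x = v x - \<i> *\<^sub>C w x" for x
  have C_eq: "C (p + \<i> *\<^sub>C q) = p - \<i> *\<^sub>C q" if "p \<in> V" "q \<in> V" for p q
    using uniq[OF dec[of "p + \<i> *\<^sub>C q", symmetric] vV that(1) wV that(2)] by (simp add: C_def)
  note simps = complex_vector.scale_right_distrib complex_vector.scale_right_diff_distrib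
    complex_vector.scale_left_distrib complex_vector.scale_left_diff_distrib
  have "C (x + y) = C x + C y" for x y
  proof -
    have "x + y = (v x + v y) + \<i> *\<^sub>C (w x + w y)"
      by (subst dec[of x], subst dec[of y]) (simp add: simps)
    then show ?thesis
      using C_eq[of "v x + v y" "w x + w y"] vV wV V
      by (simp add: C_def subspace_add simps)
  qed
  moreover have "C (c *\<^sub>C x) = cnj c *\<^sub>C C x" for c x
  proof -
    let ?p = "Re c *\<^sub>R v x - Im c *\<^sub>R w x" and ?q = "Re c *\<^sub>R w x + Im c *\<^sub>R v x"
    have c: "c = Re c + \<i> * Im c" "cnj c = Re c - \<i> * Im c"
      by (simp_all add: complex_eq_iff)
    have "c *\<^sub>C x = ?p + \<i> *\<^sub>C ?q"
      by (subst dec[of x], subst c(1)) (simp add: simps scaleR_scaleC algebra_simps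
        complex_vector.scale_scale)
    moreover have "cnj c *\<^sub>C C x = ?p - \<i> *\<^sub>C ?q"
      unfolding C_def by (subst c(2)) (simp add: simps scaleR_scaleC algebra_simps
        complex_vector.scale_scale)
    ultimately show ?thesis
      using C_eq[of ?p ?q] vV wV V by (simp add: subspace_add subspace_diff subspace_scale)
  qed
  moreover have "C (C x) = x" for x
  proof -
    have "C x = v x + \<i> *\<^sub>C (- w x)"
      by (simp add: C_def complex_vector.scale_minus_right)
    then have "C (C x) = v x - \<i> *\<^sub>C (- w x)"
      using C_eq[of "v x" "- w x"] vV wV V by (simp add: subspace_neg)
    then show ?thesis
      using dec[of x] by (simp add: complex_vector.scale_minus_right)
  qed
  moreover have "cinner (C x) (C y) = cinner y x" for x y
  proof -
    have "cinner (C x) (C y) = cinner (v y + \<i> *\<^sub>C w y) (v x + \<i> *\<^sub>C w x)"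
      unfolding C_def using comm[OF vV vV, of x y] comm[OF wV wV, of x y]
        comm[OF vV wV, of x y] comm[OF wV vV, of x y]
      by (simp add: cinner_add_left cinner_add_right cinner_diff_left cinner_diff_right
          cinner_scaleC_left cinner_scaleC_right algebra_simps)
    then show ?thesis
      using dec by metis
  qed
  ultimately have "conjugation C"
    unfolding conjugation_def by blast
  moreover have "cinner (T x) (C y) = cinner (T y) (C x)" for x y
  proof -
    have "cinner (T (v x + \<i> *\<^sub>C w x)) (v y - \<i> *\<^sub>C w y)
      = cinner (T (v y + \<i> *\<^sub>C w y)) (v x - \<i> *\<^sub>C w x)"
      using sym[OF vV vV, of x y] sym[OF wV wV, of x y] sym[OF vV wV, of x y] sym[OF wV vV, of x y]
      by (simp add: T' cinner_add_left cinner_diff_right cinner_scaleC_left cinner_scaleC_right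
          algebra_simps)
    then show ?thesis
      unfolding C_def using dec by metis
  qed
  ultimately show ?thesis
    using complex_symmetric_if_symmetric_form[OF T] by blast
qed

text \<open>
  The passage from the part of the space that \<open>T\<close> sees to the whole space. A vector \<open>z\<close> orthogonal to
  the maximal set \<open>V\<close> satisfies \<open>T z = 0\<close> and is orthogonal to the range of \<open>T\<close>, so it forms
  symmetric pairs with all of \<open>V\<close>; hence \<open>z\<close> lies in \<open>V\<close> and is orthogonal to itself.
\<close>

lemma complex_symmetric_if_symmetric_on_support:
  fixes T :: "'a::chilbert_space \<Rightarrow> 'a"
  assumes T: "bounded_clinear T"
    and pair: "\<And>x y. x \<in> A \<Longrightarrow> y \<in> A \<Longrightarrow> symmetric_pair T x y"
    and ker: "\<And>z. (\<And>x. x \<in> A \<Longrightarrow> cinner z x = 0) \<Longrightarrow> T z = 0"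
    and ran: "\<And>z y. (\<And>x. x \<in> A \<Longrightarrow> cinner z x = 0) \<Longrightarrow> cinner (T y) z = 0"
  shows "complex_symmetric T"
proof -
  obtain V where AV: "A \<subseteq> V" and V: "V = {x. \<forall>y\<in>V. symmetric_pair T x y}"
    using maximal_symmetric_set[of A T] pair by blast
  have V': "V = (\<Inter>y\<in>V. {x. symmetric_pair T x y})"
    by (subst V) auto
  show ?thesis
  proof (rule complex_symmetric_if_symmetric_real_form[OF T])
    show "subspace V"
      by (subst V') (auto intro: subspace_Int symmetric_pairs_subspace[OF T])
    show "closed V"
      by (subst V') (auto intro: symmetric_pairs_closed[OF T])
    show "symmetric_pair T x y" if "x \<in> V" "y \<in> V" for x y
      using V that by blast
    fix z assume z: "\<And>y. y \<in> V \<Longrightarrow> cinner z y = 0"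
    then have "T z = 0" "\<And>y. cinner (T y) z = 0"
      using AV ker[of z] ran[of z] by blast+
    then have "\<forall>y\<in>V. symmetric_pair T z y"
      using z by (simp add: symmetric_pair_def)
    then have "z \<in> V"
      using V by blast
    then show "z = 0"
      using z[of z] by simp
  qed
qed


section \<open>Operators with a symmetric matrix on their initial space\<close>

definition corthonormal :: "'a::complex_inner set \<Rightarrow> bool"
  where "corthonormal E \<longleftrightarrow> (\<forall>e\<in>E. \<forall>f\<in>E. cinner e f = (if e = f then 1 else 0))"

lemma corthonormalD:
  "corthonormal E \<Longrightarrow> e \<in> E \<Longrightarrow> f \<in> E \<Longrightarrow> cinner e f = (if e = f then 1 else 0)"
  by (simp add: corthonormal_def)

text \<open>
  The expansion hypothesis says that \<open>T\<close> vanishes on the orthogonal complement of \<open>E\<close>. Write \<open>A\<close> for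
  the matrix \<open>\<langle>T e, f\<rangle>\<close>. Every inner product needed to verify that the vectors \<open>e + T e\<close> and
  \<open>\<i> (e - T e)\<close> form symmetric pairs is, up to conjugation, an entry of the identity, of \<open>A\<close>, or of
  \<open>A\<^sup>2\<close>, and all of these matrices are symmetric.
\<close>

lemma complex_symmetric_if_symmetric_matrix:
  fixes T :: "'a::chilbert_space \<Rightarrow> 'a"
  assumes T: "bounded_clinear T" and E: "finite E" "corthonormal E"
    and iso: "\<And>e f. e \<in> E \<Longrightarrow> f \<in> E \<Longrightarrow> cinner (T e) (T f) = cinner e f"
    and expand: "\<And>x. T x = (\<Sum>e\<in>E. cinner x e *\<^sub>C T e)"
    and sym: "\<And>e f. e \<in> E \<Longrightarrow> f \<in> E \<Longrightarrow> cinner (T e) f = cinner (T f) e"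
  shows "complex_symmetric T"
proof -
  note T' = bounded_clinearD[OF T]
  have cinner_T: "cinner (T x) y = (\<Sum>g\<in>E. cinner x g * cinner (T g) y)" for x y
    by (subst expand) (simp add: cinner_sum_left cinner_scaleC_left)
  \<comment> \<open>This is an entry of the square of the matrix, which is symmetric with it.\<close>
  have sq: "cinner (T (T e)) f = cinner (T (T f)) e" if "e \<in> E" "f \<in> E" for e f
  proof -
    have "cinner (T (T e)) f = (\<Sum>g\<in>E. cinner (T e) g * cinner (T f) g)"
      unfolding cinner_T[of "T e"] using that by (intro sum.cong) (auto simp: sym)
    also have "\<dots> = cinner (T (T f)) e"
      unfolding cinner_T[of "T f"] using that by (intro sum.cong) (auto simp: sym)
    finally show ?thesis .
  qed
  have cube: "cinner (T (T e)) (T f) = cinner (T e) f" if "e \<in> E" "f \<in> E" for e f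
  proof -
    have "cinner (T (T e)) (T f) = (\<Sum>g\<in>E. if g = f then cinner (T e) g else 0)"
      unfolding cinner_T[of "T e"] using that corthonormalD[OF E(2)]
      by (intro sum.cong) (auto simp: iso)
    then show ?thesis
      using E(1) that by simp
  qed
  have rev: "cinner e (T f) = cnj (cinner (T e) f)" if "e \<in> E" "f \<in> E" for e f
    using cinner_commute[of e "T f"] sym[OF that] by simp
  have delta: "cinner e f = cinner f e" "Im (cinner f e) = 0" if "e \<in> E" "f \<in> E" for e f
    using corthonormalD[OF E(2)] that by auto
  have pp: "symmetric_pair T (e + T e) (f + T f)" if "e \<in> E" "f \<in> E" for e f
    using that sq[OF that] sym[OF that] delta[OF that]
    by (simp add: symmetric_pair_def T' cinner_add_left cinner_add_right iso rev cube)
  have mm: "symmetric_pair T (\<i> *\<^sub>C (e - T e)) (\<i> *\<^sub>C (f - T f))" if "e \<in> E" "f \<in> E" for e f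
    using that sq[OF that] sym[OF that] delta[OF that]
    by (simp add: symmetric_pair_def T' cinner_diff_left cinner_diff_right cinner_scaleC_left
        cinner_scaleC_right iso rev cube)
  have pm: "symmetric_pair T (e + T e) (\<i> *\<^sub>C (f - T f))" if "e \<in> E" "f \<in> E" for e f
    using that sq[OF that] sym[OF that] delta[OF that]
    by (simp add: symmetric_pair_def T' cinner_add_left cinner_add_right cinner_diff_left
        cinner_diff_right cinner_scaleC_left cinner_scaleC_right iso rev cube algebra_simps)
  let ?A = "(\<lambda>e. e + T e) ` E \<union> (\<lambda>e. \<i> *\<^sub>C (e - T e)) ` E"
  \<comment> \<open>The complex span of this set contains \<open>e\<close> and \<open>T e\<close>, hence the support and the range of \<open>T\<close>.\<close>
  have orth: "cinner z e = 0 \<and> cinner z (T e) = 0"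
    if "\<And>x. x \<in> ?A \<Longrightarrow> cinner z x = 0" "e \<in> E" for z e
  proof -
    have "cinner z (e + T e) = 0" "cinner z (\<i> *\<^sub>C (e - T e)) = 0"
      using that by blast+
    then show ?thesis
      by (simp add: cinner_add_right cinner_diff_right cinner_scaleC_right)
  qed
  show ?thesis
  proof (rule complex_symmetric_if_symmetric_on_support[OF T,
        where A = "?A"])
    show "symmetric_pair T x y"
      if "x \<in> ?A"
        "y \<in> ?A" for x y
      using that pp mm pm symmetric_pair_commute[of T] by blast
    fix z
    assume z: "\<And>x. x \<in> ?A \<Longrightarrow> cinner z x = 0"
    have zE: "cinner z e = 0 \<and> cinner z (T e) = 0" if "e \<in> E" for e
      using orth[of z e] z that by blast
    show "T z = 0"
      by (subst expand) (intro sum.neutral ballI, simp add: zE)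
    have "cinner (T e) z = 0" if "e \<in> E" for e
      using zE[OF that] cinner_commute[of "T e" z] by simp
    then show "cinner (T y) z = 0" for y
      by (simp add: cinner_T[of y])
  qed
qed


section \<open>Orthonormal bases of the initial space\<close>

definition initial_space :: "('a::complex_inner \<Rightarrow> 'b::complex_inner) \<Rightarrow> 'a set"
  where "initial_space T = {x. \<forall>y. T y = 0 \<longrightarrow> cinner x y = 0}"

lemma initial_space_closed_under:
  assumes "x \<in> initial_space T" "y \<in> initial_space T"
  shows "x + y \<in> initial_space T" "c *\<^sub>C x \<in> initial_space T"
  using assms by (auto simp: initial_space_def cinner_add_left cinner_scaleC_left)

lemma partial_isometry_cinner:
  assumes T: "partial_isometry T" and x: "x \<in> initial_space T" and y: "y \<in> initial_space T"
  shows "cinner (T x) (T y) = cinner x y"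
proof -
  have bcl: "bounded_clinear T"
    and norm: "\<And>x. x \<in> initial_space T \<Longrightarrow> norm (T x) = norm x"
    using T by (auto simp: partial_isometry_def initial_space_def)
  note T' = bounded_clinearD[OF bcl]
  have "inner (T x) (T y) = inner x y" if "y \<in> initial_space T" for y
    unfolding dot_norm T'(1)[symmetric]
    using norm initial_space_closed_under(1)[OF x that] x that by simp
  from this[OF y] this[OF initial_space_closed_under(2)[OF y y, of \<i>]] show ?thesis
    by (simp add: cinner_eq_Complex_inner T')
qed

text \<open>
  Subtract from \<open>x\<close> its projection onto the kernel. The kernel is a complex subspace, so real
  orthogonality to it implies complex orthogonality.
\<close>

lemma initial_space_representative:
  fixes T :: "'a::chilbert_space \<Rightarrow> 'b::complex_inner"
  assumes T: "bounded_clinear T"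
  obtains m where "m \<in> initial_space T" "T (x - m) = 0"
proof -
  note T' = bounded_clinearD[OF T]
  have "subspace {x. T x = 0}"
    by (auto simp: subspace_def T')
  moreover have "closed {x. T x = 0}"
    by (intro closed_Collect_eq T' continuous_intros)
  ultimately obtain p where p: "T p = 0" "\<And>y. T y = 0 \<Longrightarrow> inner (x - p) y = 0"
    using closed_subspace_projection[of "{x. T x = 0}" x] by blast
  have "cinner (x - p) y = 0" if "T y = 0" for y
    using p(2)[of y] p(2)[of "\<i> *\<^sub>C y"] that by (simp add: T' cinner_eq_Complex_inner complex_eq_iff)
  then show thesis
    using that[of "x - p"] p(1) by (simp add: initial_space_def)
qed

lemma corthonormal_independent:
  assumes E: "finite E" "corthonormal E"
  shows "\<not> cdependent E"
proof (rule complex_vector.independent_if_scalars_zero[OF E(1)])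
  fix u e assume sum: "(\<Sum>f\<in>E. u f *\<^sub>C f) = 0" and e: "e \<in> E"
  have "0 = cinner (\<Sum>f\<in>E. u f *\<^sub>C f) e"
    by (simp add: sum)
  also have "\<dots> = (\<Sum>f\<in>E. if f = e then u f else 0)"
    unfolding cinner_sum_left using e corthonormalD[OF E(2)]
    by (intro sum.cong) (auto simp: cinner_scaleC_left)
  finally show "u e = 0"
    using E(1) e by simp
qed

text \<open>
  \<open>T\<close> maps an orthonormal subset of its initial space injectively to an orthonormal, hence
  independent, subset of its range.
\<close>

lemma card_orthonormal_le_crank:
  assumes T: "partial_isometry T" and rank: "crank T \<le> enat n"
    and E: "finite E" "corthonormal E" "E \<subseteq> initial_space T"
  shows "card E \<le> n"
proof -
  have iso: "cinner (T e) (T f) = (if e = f then 1 else 0)" if "e \<in> E" "f \<in> E" for e f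
    using partial_isometry_cinner[OF T, of e f] corthonormalD[OF E(2) that] E(3) that
    by (simp add: subset_iff)
  have inj: "inj_on T E"
    by (rule inj_onI) (metis iso zero_neq_one)
  have "corthonormal (T ` E)"
    using iso inj_onD[OF inj] by (auto simp: corthonormal_def)
  then have ind: "\<not> cdependent (T ` E)"
    using E(1) by (intro corthonormal_independent) auto
  obtain F where F: "finite F" "cspan F = cspan (range T)" and n: "cdim (range T) \<le> n"
    using rank by (auto simp: crank_def split: if_splits)
  obtain B where B: "B \<subseteq> range T" "\<not> cdependent B" "range T \<subseteq> cspan B" "card B = cdim (range T)"
    using complex_vector.basis_exists by blast
  have "finite B"
    using complex_vector.independent_span_bound[OF F(1) B(2)] B(1) F(2)
      complex_vector.span_superset[of "range T"] by blast
  then have "card (T ` E) \<le> card B"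
    using complex_vector.independent_span_bound[OF _ ind, of B] B(3) by blast
  then show ?thesis
    using B(4) n card_image[OF inj] by simp
qed

text \<open>
  The rank bounds the size of orthonormal subsets of the initial space, so there is a largest size
  \<open>k\<close>, and an orthonormal set of that size cannot be enlarged. The expansion of \<open>T\<close> is stated for all
  sets of size \<open>k\<close>, so that it survives a change of basis.
\<close>

lemma initial_space_orthonormal_basis:
  fixes T :: "'a::chilbert_space \<Rightarrow> 'a"
  assumes T: "partial_isometry T" and rank: "crank T \<le> enat n"
  obtains k where "k \<le> n"
    "\<exists>E. finite E \<and> corthonormal E \<and> E \<subseteq> initial_space T \<and> card E = k"
    "\<And>E x. \<lbrakk>finite E; corthonormal E; E \<subseteq> initial_space T; card E = k\<rbrakk> \<Longrightarrow>
      T x = (\<Sum>e\<in>E. cinner x e *\<^sub>C T e)"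
proof -
  have bcl: "bounded_clinear T"
    using T by (simp add: partial_isometry_def)
  note T' = bounded_clinearD[OF bcl]
  define P where "P E \<longleftrightarrow> finite E \<and> corthonormal E \<and> E \<subseteq> initial_space T" for E
  have "\<exists>E. P E \<and> (\<forall>F. P F \<longrightarrow> card F \<le> card E)"
  proof (rule ex_has_greatest_nat[of P "{}" card "Suc n"])
    show "P {}"
      by (simp add: P_def corthonormal_def)
    show "\<forall>F. P F \<longrightarrow> card F < Suc n"
      using card_orthonormal_le_crank[OF T rank] by (simp add: P_def less_Suc_eq_le)
  qed
  then obtain D where D: "P D" and max: "\<And>F. P F \<Longrightarrow> card F \<le> card D"
    by blast
  have "T x = (\<Sum>e\<in>E. cinner x e *\<^sub>C T e)" if E: "P E" and card: "card E = card D" for E x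
  proof (rule ccontr)
    assume neq: "T x \<noteq> (\<Sum>e\<in>E. cinner x e *\<^sub>C T e)"
    have fin: "finite E" and orth: "corthonormal E" and sub: "E \<subseteq> initial_space T"
      using E by (auto simp: P_def)
    \<comment> \<open>The part of \<open>x\<close> orthogonal to \<open>E\<close> yields, after removing its component in the kernel,
      one more vector for \<open>E\<close>.\<close>
    define z where "z = x - (\<Sum>e\<in>E. cinner x e *\<^sub>C e)"
    have "T (\<Sum>e\<in>E. cinner x e *\<^sub>C e) = (\<Sum>e\<in>E. cinner x e *\<^sub>C T e)"
      using fin by (induction E rule: finite_induct) (simp_all add: T')
    then have Tz: "T z \<noteq> 0"
      using neq by (simp add: z_def T')
    have z: "cinner z e = 0" if e: "e \<in> E" for e
    proof -
      have "cinner (\<Sum>f\<in>E. cinner x f *\<^sub>C f) e = (\<Sum>f\<in>E. if f = e then cinner x f else 0)"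
        unfolding cinner_sum_left using e corthonormalD[OF orth]
        by (intro sum.cong) (auto simp: cinner_scaleC_left)
      then show ?thesis
        using fin e by (simp add: z_def cinner_diff_left)
    qed
    obtain m where m: "m \<in> initial_space T" "T (z - m) = 0"
      using initial_space_representative[OF bcl] by blast
    have m0: "m \<noteq> 0"
      using m(2) Tz by auto
    have me: "cinner m e = 0" if e: "e \<in> E" for e
    proof -
      have "cinner e (z - m) = 0"
        using sub e m(2) by (auto simp: initial_space_def)
      then have "cinner (z - m) e = 0"
        using cinner_commute[of "z - m" e] by simp
      then show ?thesis
        using z[OF e] by (simp add: cinner_diff_left)
    qed
    define g where "g = complex_of_real (inverse (norm m)) *\<^sub>C m"
    have "cinner g g = complex_of_real (inverse (norm m) * inverse (norm m)) * cinner m m"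
      by (simp add: g_def cinner_scaleC_left cinner_scaleC_right)
    also have "\<dots> = 1"
      using m0 by (simp add: cinner_self power2_eq_square field_simps)
    finally have gg: "cinner g g = 1" .
    have ge: "cinner g e = 0 \<and> cinner e g = 0" if "e \<in> E" for e
      using me[OF that] cinner_commute[of e m]
      by (simp add: g_def cinner_scaleC_left cinner_scaleC_right)
    have gE: "g \<notin> E"
      using gg ge by force
    have "P (insert g E)"
      using fin orth sub gE gg ge initial_space_closed_under(2)[OF m(1) m(1)]
      by (auto simp: P_def corthonormal_def g_def[symmetric]) (simp add: g_def)
    then have "card (insert g E) \<le> card D"
      by (rule max)
    then show False
      using fin gE card by simp
  qed
  moreover have "card D \<le> n"
    using card_orthonormal_le_crank[OF T rank] D by (simp add: P_def)
  ultimately show thesis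
    using that[of "card D"] D unfolding P_def by blast
qed


section \<open>Symmetrising a two by two matrix\<close>

text \<open>
  The numbers stand for a matrix with rows \<open>a, b\<close> and \<open>c, d\<close>. Up to a factor \<open>1 / 2\<close>, the two
  sides are its off-diagonal entries in the orthonormal basis \<open>(e + w f) / \<surd>2\<close>, \<open>g (e - w f) / \<surd>2\<close>.
  Rotating the phase \<open>w\<close> makes these entries equal in modulus, as the difference of their squared
  moduli is \<open>4 Re (w \<mu>)\<close> for a fixed number \<open>\<mu>\<close>; then the phase \<open>g\<close> makes them equal.
\<close>

lemma exists_unimodular_symmetrisers:
  fixes a b c d :: complex
  obtains w g where "cmod w = 1" "cmod g = 1"
    "cnj g * (a - cnj w * b + w * c - d) = g * (a + cnj w * b - w * c - d)"
proof -
  define k where "k = cnj (a - d)"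
  define \<mu> where "\<mu> = k * c - cnj (k * b)"
  \<comment> \<open>This choice makes \<open>w \<mu>\<close> purely imaginary.\<close>
  define w where "w = (if \<mu> = 0 then 1 else \<i> * cnj (sgn \<mu>))"
  define u where "u = a - cnj w * b + w * c - d"
  define v where "v = a + cnj w * b - w * c - d"
  have w: "cmod w = 1"
    by (simp add: w_def norm_mult norm_sgn)
  have "w * \<mu> = \<i> * (cmod \<mu>)"
    by (simp add: w_def sgn_div_norm scaleR_conv_of_real complex_norm_square[symmetric]
        power2_eq_square field_simps)
  then have "Re (w * \<mu>) = 0"
    by simp
  moreover have "(cmod u)\<^sup>2 - (cmod v)\<^sup>2 = 4 * Re (w * \<mu>)"
    unfolding u_def v_def \<mu>_def k_def cmod_power2 by (simp add: algebra_simps power2_eq_square)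
  ultimately have uv: "cmod u = cmod v"
    by simp
  \<comment> \<open>As \<open>cnj g\<close> is the inverse of \<open>g\<close>, the goal amounts to \<open>u = g\<^sup>2 v\<close>.\<close>
  define g where "g = (if v = 0 then 1 else csqrt (u / v))"
  have g: "cmod g = 1"
    using uv by (cases "v = 0") (simp_all add: g_def norm_divide)
  have "u = g\<^sup>2 * v"
    using uv by (cases "v = 0") (simp_all add: g_def)
  then have "cnj g * u = (g * cnj g) * (g * v)"
    by (simp add: power2_eq_square)
  also have "g * cnj g = 1"
    using g complex_norm_square[of g] by simp
  finally show thesis
    using that[OF w g] by (simp add: u_def v_def)
qed

lemma symmetric_orthonormal_pair:
  assumes T: "bounded_clinear T" and E: "corthonormal {e, f}" "e \<noteq> f"
  obtains p q where "p \<noteq> q" "corthonormal {p, q}" "p \<in> cspan {e, f}" "q \<in> cspan {e, f}"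
    "cinner (T p) q = cinner (T q) p"
proof -
  note T' = bounded_clinearD[OF T]
  note expand = T' cinner_add_left cinner_add_right cinner_diff_left cinner_diff_right
    cinner_scaleC_left cinner_scaleC_right
  have ef: "cinner e e = 1" "cinner f f = 1" "cinner e f = 0" "cinner f e = 0"
    using E by (auto simp: corthonormal_def)
  obtain w g where w: "cmod w = 1" and g: "cmod g = 1"
    and eq: "cnj g * (cinner (T e) e - cnj w * cinner (T e) f + w * cinner (T f) e - cinner (T f) f)
      = g * (cinner (T e) e + cnj w * cinner (T e) f - w * cinner (T f) e - cinner (T f) f)"
    using exists_unimodular_symmetrisers by blast
  have ww: "w * cnj w = 1" and gg: "g * cnj g = 1"
    using w g complex_norm_square[of w] complex_norm_square[of g] by simp_all
  define s where "s = complex_of_real (1 / sqrt 2)"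
  have s: "cnj s = s" "s * s = 1 / 2"
    by (simp_all add: s_def flip: of_real_mult)
  define p where "p = s *\<^sub>C (e + w *\<^sub>C f)"
  define q where "q = (s * g) *\<^sub>C (e - w *\<^sub>C f)"
  have pp: "cinner p p = 1"
  proof -
    have "cinner p p = (s * s) * (1 + w * cnj w)"
      by (simp add: p_def expand ef s(1) algebra_simps)
    then show ?thesis by (simp add: s ww)
  qed
  have qq: "cinner q q = 1"
  proof -
    have "cinner q q = (s * s) * (g * cnj g) * (1 + w * cnj w)"
      by (simp add: q_def expand ef s(1) algebra_simps)
    then show ?thesis by (simp add: s ww gg)
  qed
  have pq: "cinner p q = 0"
  proof -
    have "cinner p q = (s * s) * cnj g * (1 - w * cnj w)"
      by (simp add: p_def q_def expand ef s(1) algebra_simps)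
    then show ?thesis by (simp add: ww)
  qed
  have sym: "cinner (T p) q = cinner (T q) p"
  proof -
    have "cinner (T p) q = (s * s) * (cnj g * (cinner (T e) e - cnj w * cinner (T e) f
        + w * cinner (T f) e - (w * cnj w) * cinner (T f) f))"
      unfolding p_def q_def by (simp add: expand s(1) algebra_simps)
    moreover have "cinner (T q) p = (s * s) * (g * (cinner (T e) e + cnj w * cinner (T e) f
        - w * cinner (T f) e - (w * cnj w) * cinner (T f) f))"
      unfolding p_def q_def by (simp add: expand s(1) algebra_simps)
    ultimately show ?thesis
      using eq by (simp add: ww)
  qed
  have "p \<noteq> q" "corthonormal {p, q}"
    using pp qq pq cinner_commute[of q p] by (auto simp: corthonormal_def)
  moreover have "p \<in> cspan {e, f}" "q \<in> cspan {e, f}"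
    unfolding p_def q_def
    by (intro complex_vector.span_scale complex_vector.span_add complex_vector.span_diff
        complex_vector.span_base; simp)+
  ultimately show thesis
    using that sym by blast
qed

section \<open>Partial isometries of rank at most two\<close>

theorem corollary1:
  fixes T :: "'a::chilbert_space \<Rightarrow> 'a"
  assumes "separable_space (euclidean :: 'a topology)"
    and "bounded_clinear T"
    and "partial_isometry T"
    and "crank T \<le> 2"
  shows "complex_symmetric T"
proof -
  note T = \<open>bounded_clinear T\<close> and iso = \<open>partial_isometry T\<close>
  have "crank T \<le> enat 2"
    using assms(4) by (simp add: numeral_eq_enat)
  then obtain k where k: "k \<le> 2"
    and ex: "\<exists>E. finite E \<and> corthonormal E \<and> E \<subseteq> initial_space T \<and> card E = k"
    and expand: "\<And>E x. \<lbrakk>finite E; corthonormal E; E \<subseteq> initial_space T; card E = k\<rbrakk> \<Longrightarrow>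
      T x = (\<Sum>e\<in>E. cinner x e *\<^sub>C T e)"
    by (rule initial_space_orthonormal_basis[OF iso]) auto
  from ex obtain E where E: "finite E" "corthonormal E" "E \<subseteq> initial_space T" "card E = k"
    by blast
  \<comment> \<open>Bases of size at most one have a symmetric matrix; those of size two are rotated.\<close>
  have "\<exists>F. finite F \<and> corthonormal F \<and> F \<subseteq> initial_space T \<and> card F = k \<and>
    (\<forall>e\<in>F. \<forall>f\<in>F. cinner (T e) f = cinner (T f) e)"
  proof (cases "k = 2")
    case True
    then obtain e f where ef: "E = {e, f}" "e \<noteq> f"
      using E(4) True by (auto simp: card_2_iff)
    obtain p q where pq: "p \<noteq> q" "corthonormal {p, q}" "p \<in> cspan {e, f}" "q \<in> cspan {e, f}"
      "cinner (T p) q = cinner (T q) p"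
      using symmetric_orthonormal_pair[OF T _ ef(2)] E(2) unfolding ef(1) by blast
    have "0 \<in> initial_space T"
      by (simp add: initial_space_def)
    then have "csubspace (initial_space T)"
      using initial_space_closed_under by (auto intro!: complex_vector.subspaceI)
    then have "cspan {e, f} \<subseteq> initial_space T"
      using E(3) ef(1) by (intro complex_vector.span_minimal) auto
    then show ?thesis
      using pq True by (intro exI[of _ "{p, q}"]) auto
  next
    case False
    then have "card E \<le> 1"
      using k E(4) by simp
    then have "\<forall>e\<in>E. \<forall>f\<in>E. e = f"
      using E(1) by (metis card_le_Suc0_iff_eq One_nat_def)
    then show ?thesis
      using E by (intro exI[of _ E]) auto
  qed
  then obtain F where F: "finite F" "corthonormal F" "F \<subseteq> initial_space T" "card F = k"
    and sym: "\<And>e f. e \<in> F \<Longrightarrow> f \<in> F \<Longrightarrow> cinner (T e) f = cinner (T f) e"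
    by blast
  show ?thesis
    using partial_isometry_cinner[OF iso] F(3)
    by (intro complex_symmetric_if_symmetric_matrix[OF T F(1,2) _ expand[OF F] sym]) auto
qed

end
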